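(* Let $\mathcal H$ be a separable complex Hilbert space and let $(T_1,T_2)$ be a left-inverse commuting pair of bounded linear operators on $\mathcal H$. Suppose that each of $T_1$ and $T_2$ admits a Wold-type decomposition. Put $\mathcal E_i=\ker T_i^*$ for $i=1,2$, and $$\mathcal H_{00}=\bigcap_{m,n\ge 0}T_1^mT_2^n\mathcal H,\qquad \mathcal H_{01}=\bigvee_{n\ge 0}T_2^n\Big(\bigcap_{m\ge 0}T_1^m(\mathcal E_2)\Big),$$ $$\mathcal H_{10}=\bigcap_{n\ge 0}T_2^n\Big(\bigvee_{m\ge 0}T_1^m(\mathcal E_1)\Big),\qquad \mathcal H_{11}=\bigvee_{m,n\ge 0}T_1^mT_2^n(\mathcal E_1\cap\mathcal E_2).$$ Then $\mathcal H$ is the orthogonal direct sum $$\mathcal H=\mathcal H_{00}\oplus\mathcal H_{01}\oplus\mathcal H_{10}\oplus\mathcal H_{11},$$ where for all $i,j\in\{0,1\}$ the subspace $\mathcal H_{ij}$ is both $T_1$-reducing and $T_2$-reducing, $T_1$ acts unitarily on $\mathcal H_{00}$ and on $\mathcal H_{01}$, and $T_2$ acts unitarily on $\mathcal H_{00}$ and on $\mathcal H_{10}$.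
   Context: $\bigvee$ denotes closed linear span. A closed subspace is $T$-reducing if it is invariant under both $T$ and $T^*$. For a bounded operator $T$, $\mathcal H_\infty(T)=\bigcap_{m\ge1}T^m\mathcal H$. A left invertible operator $T$ on $\mathcal H$ admits a Wold-type decomposition if $\mathcal H=\mathcal H_\infty(T)\oplus\bigvee_{m\ge0}T^m(\ker T^* )$ (orthogonal direct sum), $\mathcal H_\infty(T)$ is $T$-reducing, and $T|_{\mathcal H_\infty(T)}$ is unitary. A tuple $(T_1,\dots,T_n)$ of left invertible, pairwise commuting operators is left-inverse commuting if $L_iT_j=T_jL_i$ for all $1\le i\ne j\le n$, where $L_i=(T_i^*T_i)^{-1}T_i^*$. *)

theory Defs
  imports "HOL-Analysis.Analysis"
begin

section \<open>Complex Hilbert spaces\<close>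

class complex_vector = real_vector +
  fixes scaleC :: "complex \<Rightarrow> 'a \<Rightarrow> 'a"  (infixr \<open>*\<^sub>C\<close> 75)
  assumes scaleC_add_right: "c *\<^sub>C (x + y) = c *\<^sub>C x + c *\<^sub>C y"
    and scaleC_add_left: "(c + d) *\<^sub>C x = c *\<^sub>C x + d *\<^sub>C x"
    and scaleC_scaleC: "c *\<^sub>C (d *\<^sub>C x) = (c * d) *\<^sub>C x"
    and scaleR_scaleC: "r *\<^sub>R x = complex_of_real r *\<^sub>C x"

interpretation complex_vector: vector_space "scaleC :: complex \<Rightarrow> 'a \<Rightarrow> 'a::complex_vector"
proof
  fix x :: 'a
  show "1 *\<^sub>C x = x"
    using scaleR_scaleC[of 1 x] by simp
qed (rule scaleC_add_right scaleC_add_left scaleC_scaleC)+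

abbreviation cspan :: "'a::complex_vector set \<Rightarrow> 'a set"
  where "cspan \<equiv> complex_vector.span"

abbreviation csubspace :: "'a::complex_vector set \<Rightarrow> bool"
  where "csubspace \<equiv> complex_vector.subspace"

text \<open>
  The inner product is linear in its first argument. Its real part is the real inner product of
  the superclass, from which positive definiteness and \<open>norm x = sqrt (Re (cinner x x))\<close>
  are inherited.
\<close>

class complex_inner = complex_vector + real_inner +
  fixes cinner :: "'a \<Rightarrow> 'a \<Rightarrow> complex"
  assumes cinner_commute: "cinner x y = cnj (cinner y x)"
    and cinner_add_left: "cinner (x + y) z = cinner x z + cinner y z"
    and cinner_scaleC_left: "cinner (c *\<^sub>C x) y = c * cinner x y"
    and inner_eq_Re_cinner: "inner x y = Re (cinner x y)"

class complex_hilbert = complex_inner + complete_space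

lemma cinner_self: "cinner x x = complex_of_real ((norm x)\<^sup>2)"
  for x :: "'a::complex_inner"
proof -
  have "Im (cinner x x) = 0"
    using arg_cong[OF cinner_commute[of x x], of Im] by simp
  then show ?thesis
    by (simp add: complex_eq_iff power2_norm_eq_inner inner_eq_Re_cinner)
qed

instantiation complex :: complex_hilbert
begin

definition scaleC_complex :: "complex \<Rightarrow> complex \<Rightarrow> complex"
  where "scaleC_complex c x = c * x"

definition cinner_complex :: "complex \<Rightarrow> complex \<Rightarrow> complex"
  where "cinner_complex x y = x * cnj y"

instance
  by standard
    (auto simp: scaleC_complex_def cinner_complex_def inner_complex_def algebra_simps scaleR_conv_of_real)

end

definition ccspan :: "'a::complex_inner set \<Rightarrow> 'a set"
  where "ccspan S = closure (cspan S)"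

definition closed_csubspace :: "'a::complex_inner set \<Rightarrow> bool"
  where "closed_csubspace M \<longleftrightarrow> csubspace M \<and> closed M"

definition orthogonal_direct_sum :: "'a::complex_inner set list \<Rightarrow> bool"
  where "orthogonal_direct_sum Ms \<longleftrightarrow>
    (\<forall>M\<in>set Ms. closed_csubspace M) \<and>
    sorted_wrt (\<lambda>M N. \<forall>x\<in>M. \<forall>y\<in>N. cinner x y = 0) Ms \<and>
    (\<forall>x. \<exists>xs. list_all2 (\<in>) xs Ms \<and> x = sum_list xs)"


section \<open>Operators\<close>

definition bounded_clinear :: "('a::complex_inner \<Rightarrow> 'a) \<Rightarrow> bool"
  where "bounded_clinear T \<longleftrightarrow> bounded_linear T \<and> (\<forall>c x. T (c *\<^sub>C x) = c *\<^sub>C T x)"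

text \<open>Meaningful for bounded operators on a Hilbert space, where the adjoint exists uniquely.\<close>

definition cadjoint :: "('a::complex_inner \<Rightarrow> 'a) \<Rightarrow> 'a \<Rightarrow> 'a"
  where "cadjoint T = (THE S. \<forall>x y. cinner (T x) y = cinner x (S y))"

definition op_kernel :: "('a::complex_inner \<Rightarrow> 'a) \<Rightarrow> 'a set"
  where "op_kernel T = {x. T x = 0}"

definition left_invertible :: "('a::complex_inner \<Rightarrow> 'a) \<Rightarrow> bool"
  where "left_invertible T \<longleftrightarrow> (\<exists>L. bounded_clinear L \<and> L \<circ> T = id)"

definition reducing :: "('a::complex_inner \<Rightarrow> 'a) \<Rightarrow> 'a set \<Rightarrow> bool"
  where "reducing T M \<longleftrightarrow> closed_csubspace M \<and> T ` M \<subseteq> M \<and> cadjoint T ` M \<subseteq> M"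

definition unitary_on :: "('a::complex_inner \<Rightarrow> 'a) \<Rightarrow> 'a set \<Rightarrow> bool"
  where "unitary_on T M \<longleftrightarrow> T ` M = M \<and> (\<forall>x\<in>M. \<forall>y\<in>M. cinner (T x) (T y) = cinner x y)"

definition hyperrange :: "('a::complex_inner \<Rightarrow> 'a) \<Rightarrow> 'a set"
  where "hyperrange T = (\<Inter>m\<in>{1..}. range (T ^^ m))"

definition wold_type_decomposition :: "('a::complex_inner \<Rightarrow> 'a) \<Rightarrow> bool"
  where "wold_type_decomposition T \<longleftrightarrow>
    bounded_clinear T \<and> left_invertible T \<and>
    orthogonal_direct_sum [hyperrange T, ccspan (\<Union>m. (T ^^ m) ` op_kernel (cadjoint T))] \<and>
    reducing T (hyperrange T) \<and>
    unitary_on T (hyperrange T)"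

text \<open>
  The left inverse \<open>(T\<^sup>* T)\<inverse> T\<^sup>*\<close>; for left invertible \<open>T\<close> on a
  Hilbert space \<open>T\<^sup>* T\<close> is bijective, so \<^const>\<open>inv\<close> is its genuine inverse.
\<close>

definition canonical_left_inverse :: "('a::complex_inner \<Rightarrow> 'a) \<Rightarrow> 'a \<Rightarrow> 'a"
  where "canonical_left_inverse T = inv (cadjoint T \<circ> T) \<circ> cadjoint T"

definition left_inverse_commuting :: "('a::complex_inner \<Rightarrow> 'a) list \<Rightarrow> bool"
  where "left_inverse_commuting Ts \<longleftrightarrow>
    (\<forall>T\<in>set Ts. bounded_clinear T \<and> left_invertible T) \<and>
    (\<forall>i<length Ts. \<forall>j<length Ts. i \<noteq> j \<longrightarrow>
      Ts ! i \<circ> Ts ! j = Ts ! j \<circ> Ts ! i \<and>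
      canonical_left_inverse (Ts ! i) \<circ> Ts ! j = Ts ! j \<circ> canonical_left_inverse (Ts ! i))"

end

theory Submission
  imports Defs
begin

text \<open>
  Write \<open>U\<^sub>i\<close> for the hyperrange of \<open>T\<^sub>i\<close> and \<open>V\<^sub>i\<close> for its orthogonal
  complement, the closed span of the \<open>T\<^sub>i\<^sup>m E\<^sub>i\<close>. As \<open>E\<^sub>i\<close> is also the kernel of
  \<open>L\<^sub>i\<close>, it is invariant under the other operator \<open>T\<^sub>j\<close>; so are the range of
  \<open>T\<^sub>i\<close>, \<open>U\<^sub>i\<close> and \<open>V\<^sub>i\<close>. A closed subspace that is invariant together with
  its complement is reducing, hence \<open>E\<^sub>i\<close>, \<open>U\<^sub>i\<close> and \<open>V\<^sub>i\<close> reduce \<open>T\<^sub>j\<close>.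
  The projection onto \<open>U\<^sub>1\<close> commutes with \<open>T\<^sub>2\<close> and therefore preserves
  \<open>U\<^sub>2\<close>, which splits the space into the four intersections of \<open>U\<^sub>1\<close> or
  \<open>V\<^sub>1\<close> with \<open>U\<^sub>2\<close> or \<open>V\<^sub>2\<close>. These are the four given subspaces: on reducing
  subspaces of \<open>U\<^sub>i\<close> the operator \<open>T\<^sub>i\<close> is onto, and for \<open>M\<close> reducing \<open>T\<close>
  whose projection preserves \<open>E\<close>, projecting shows that the part in \<open>M\<close> of the closed span
  of the \<open>T\<^sup>n E\<close> is spanned by the \<open>T\<^sup>n (M \<inter> E)\<close>.
\<close>

section \<open>Orthogonal projection and adjoints\<close>

text \<open>Near minimizers of the distance form closed nested sets \<open>S n\<close>; the
  parallelogram law shrinks their diameters, so completeness yields a common point.\<close>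

lemma nearest_point_exists:
  fixes M :: "'a::{real_inner, complete_space} set"
  assumes M: "convex M" "closed M" "M \<noteq> {}"
  obtains m where "m \<in> M" "\<And>z. z \<in> M \<Longrightarrow> dist x m \<le> dist x z"
proof -
  define d where "d = infdist x M"
  have d0: "d \<ge> 0" by (simp add: d_def infdist_nonneg)
  have d_le: "d \<le> dist x z" if "z \<in> M" for z
    using that by (simp add: d_def infdist_le)
  define S where "S n = {m \<in> M. dist x m ^ 2 \<le> d ^ 2 + 1 / real (Suc n)}" for n
  have near: "dist y z ^ 2 \<le> 4 / real (Suc n)" if "y \<in> S n" "z \<in> S n" for y z n
  proof -
    have yz: "y \<in> M" "z \<in> M" "dist x y ^ 2 \<le> d ^ 2 + 1 / real (Suc n)" "dist x z ^ 2 \<le> d ^ 2 + 1 / real (Suc n)"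
      using that by (auto simp: S_def)
    define w where "w = (1/2) *\<^sub>R y + (1/2) *\<^sub>R z"
    have "w \<in> M" unfolding w_def by (rule convexD[OF M(1) yz(1,2)]) auto
    then have "d ^ 2 \<le> dist x w ^ 2" using d_le d0 by (intro power_mono) auto
    moreover have "dist y z ^ 2 + 4 * dist x w ^ 2 = 2 * dist x y ^ 2 + 2 * dist x z ^ 2"
      by (simp add: w_def dist_norm power2_norm_eq_inner inner_diff inner_add inner_commute algebra_simps)
    ultimately show ?thesis using yz by simp
  qed
  have "\<exists>a. \<forall>n. a \<in> S n"
  proof (rule decreasing_closed_nest[of S])
    show "closed (S n)" for n
    proof -
      have "S n = M \<inter> {m. dist x m ^ 2 \<le> d ^ 2 + 1 / real (Suc n)}" by (auto simp: S_def)
      then show ?thesis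
        using M(2) by (auto intro!: closed_Int closed_Collect_le continuous_intros)
    qed
    show "S n \<noteq> {}" for n
    proof -
      have "d < sqrt (d ^ 2 + 1 / real (Suc n))"
        by (rule real_less_rsqrt) simp
      then have "Inf (dist x ` M) < sqrt (d ^ 2 + 1 / real (Suc n))"
        using M(3) by (simp add: d_def infdist_notempty)
      then obtain m where "m \<in> M" "dist x m < sqrt (d ^ 2 + 1 / real (Suc n))"
        using cInf_lessD[of "dist x ` M"] M(3) by blast
      then have "dist x m ^ 2 \<le> sqrt (d ^ 2 + 1 / real (Suc n)) ^ 2"
        by (intro power_mono) auto
      then have "dist x m ^ 2 \<le> d ^ 2 + 1 / real (Suc n)"
        by (simp add: add_nonneg_nonneg)
      then show ?thesis using \<open>m \<in> M\<close> by (auto simp: S_def)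
    qed
    show "S n \<subseteq> S m" if "m \<le> n" for m n
    proof -
      have "1 / real (Suc n) \<le> 1 / real (Suc m)" using that by (simp add: frac_le)
      then show ?thesis by (auto simp: S_def)
    qed
    show "\<exists>n. \<forall>y\<in>S n. \<forall>z\<in>S n. dist y z < e" if "e > 0" for e
    proof -
      obtain n where n: "4 / e ^ 2 < real (Suc n)"
        by (metis reals_Archimedean2 less_Suc_eq less_trans of_nat_less_iff)
      then have "4 / real (Suc n) < e ^ 2" using that by (simp add: field_simps)
      then show ?thesis
        using near that by (meson power_less_imp_less_base less_eq_real_def le_less_trans)
    qed
  qed blast
  then obtain a where a: "\<And>n. a \<in> S n" by blast
  show ?thesis
  proof
    show "a \<in> M" using a[of 0] by (simp add: S_def)
    fix z assume z: "z \<in> M"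
    have "dist x a ^ 2 \<le> d ^ 2 + e" if "e > 0" for e
    proof -
      obtain n where "1 / real (Suc n) < e"
        using \<open>e > 0\<close> nat_approx_posE by blast
      then show ?thesis using a[of n] by (simp add: S_def)
    qed
    then have "dist x a ^ 2 \<le> d ^ 2" by (rule field_le_epsilon)
    then show "dist x a \<le> dist x z"
      using d_le[OF z] d0 by (meson order_trans power2_le_imp_le)
  qed
qed

text \<open>At the nearest point \<open>m\<close>, the vector \<open>x - m\<close> has nonpositive
  inner product with every \<open>y\<close> in \<open>M\<close>; using \<open>-y\<close> as well
  forces 0.\<close>

lemma real_projection_exists:
  fixes M :: "'a::{real_inner, complete_space} set"
  assumes M: "subspace M" "closed M"
  shows "\<exists>m\<in>M. \<forall>y\<in>M. inner (x - m) y = 0"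
proof -
  obtain m where m: "m \<in> M" "\<And>z. z \<in> M \<Longrightarrow> dist x m \<le> dist x z"
    using nearest_point_exists[OF subspace_imp_convex[OF M(1)] M(2)] subspace_0[OF M(1)] by (metis empty_iff)
  have le: "inner (x - m) y \<le> 0" if "y \<in> M" for y
    using any_closest_point_dot[of M m "m + y" x] M m that
    by (simp add: subspace_imp_convex subspace_add)
  have "inner (x - m) y = 0" if "y \<in> M" for y
    using le[OF that] le[of "- y"] subspace_neg[OF M(1) that] by simp
  with m(1) show ?thesis by blast
qed

text \<open>The kernel of a nonzero \<open>f\<close> is a closed hyperplane; its normal
  \<open>v\<close>, suitably rescaled, represents \<open>f\<close>.\<close>

lemma riesz_representation:
  fixes f :: "'a::{real_inner, complete_space} \<Rightarrow> real"
  assumes f: "bounded_linear f"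
  obtains w where "\<And>x. f x = inner x w"
proof (cases "\<forall>x. f x = 0")
  case True
  then show ?thesis using that[of 0] by simp
next
  case False
  interpret f: bounded_linear f by fact
  obtain x0 where x0: "f x0 \<noteq> 0" using False by blast
  have sub: "subspace {x. f x = 0}"
    by (auto simp: subspace_def f.add f.scaleR f.zero)
  have cl: "closed {x. f x = 0}"
    by (intro closed_Collect_eq continuous_intros f.continuous_on)
  obtain m where m: "f m = 0" "\<And>y. f y = 0 \<Longrightarrow> inner (x0 - m) y = 0"
    using real_projection_exists[OF sub cl, of x0] by auto
  define v where "v = x0 - m"
  have fv: "f v \<noteq> 0" using x0 m by (simp add: v_def f.diff)
  then have v: "inner v v \<noteq> 0" using f.zero by auto
  show ?thesis
  proof (rule that)
    fix x
    have "f (x - (f x / f v) *\<^sub>R v) = 0" using fv by (simp add: f.diff f.scaleR)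
    then have "inner v (x - (f x / f v) *\<^sub>R v) = 0" using m(2) v_def by blast
    then have "inner v x = f x / f v * inner v v" by (simp add: inner_diff_right)
    then show "f x = inner x ((f v / inner v v) *\<^sub>R v)"
      using fv v by (simp add: inner_commute field_simps)
  qed
qed

section \<open>The complex inner product and the adjoint\<close>

lemma cinner_scaleC_right: "cinner x (c *\<^sub>C y) = cnj c * cinner x y"
  by (metis cinner_commute cinner_scaleC_left complex_cnj_mult)

text \<open>Testing against \<open>\<i> *\<^sub>C y\<close> recovers the imaginary part, so real
  orthogonality results carry over.\<close>

lemma cinner_eq_inner: "cinner x y = Complex (inner x y) (inner x (\<i> *\<^sub>C y))"
  by (simp add: inner_eq_Re_cinner complex_eq_iff cinner_scaleC_right)

lemma cinner_diff_left: "cinner (x - y) z = cinner x z - cinner y z"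
  by (simp add: cinner_eq_inner inner_diff_left complex_eq_iff)

lemma cinner_diff_right: "cinner z (x - y) = cinner z x - cinner z y"
  by (metis cinner_commute cinner_diff_left complex_cnj_diff)

lemma cinner_zero_left [simp]: "cinner 0 z = 0"
  by (simp add: cinner_eq_inner complex_eq_iff)

lemma cinner_zero_right [simp]: "cinner z 0 = 0"
  by (metis cinner_commute cinner_zero_left complex_cnj_zero)

lemma cinner_sym_zero: "cinner x y = 0 \<longleftrightarrow> cinner y x = 0"
  by (metis cinner_commute complex_cnj_zero)

lemma cinner_self_eq_0 [simp]: "cinner x x = 0 \<longleftrightarrow> x = 0"
  by (simp add: cinner_self)

lemma cinner_ext: "(\<And>x. cinner x y = cinner x z) \<Longrightarrow> y = z"
  by (metis cinner_diff_right cinner_self_eq_0 right_minus_eq)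

lemma csubspace_imp_subspace: "csubspace M \<Longrightarrow> subspace M"
  by (simp add: subspace_def complex_vector.subspace_def scaleR_scaleC)

lemma bounded_linear_scaleC: "bounded_linear (\<lambda>x::'a::complex_inner. c *\<^sub>C x)"
proof (rule bounded_linear_intro)
  show "norm (c *\<^sub>C x) \<le> norm x * cmod c" for x :: 'a
  proof -
    have "complex_of_real ((norm (c *\<^sub>C x))\<^sup>2) = c * cnj c * complex_of_real ((norm x)\<^sup>2)"
      by (simp only: cinner_self[symmetric] cinner_scaleC_right cinner_scaleC_left mult_ac)
    also have "\<dots> = complex_of_real ((cmod c * norm x)\<^sup>2)"
      by (simp only: complex_norm_square[symmetric] of_real_mult[symmetric] power_mult_distrib)
    finally have "(norm (c *\<^sub>C x))\<^sup>2 = (cmod c * norm x)\<^sup>2" using of_real_eq_iff by blast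
    then show ?thesis by (simp add: mult.commute)
  qed
qed (simp_all add: scaleC_add_right scaleR_scaleC scaleC_scaleC mult.commute)

lemma bounded_clinearD:
  assumes "bounded_clinear T"
  shows "bounded_linear T" "T (c *\<^sub>C x) = c *\<^sub>C T x" "T (x + y) = T x + T y" "T (x - y) = T x - T y" "T 0 = 0"
  using assms
  by (auto simp: bounded_clinear_def bounded_linear_def linear_add linear_diff linear_0)

lemma bounded_clinear_comp:
  "bounded_clinear S \<Longrightarrow> bounded_clinear T \<Longrightarrow> bounded_clinear (S \<circ> T)"
  by (auto simp: bounded_clinear_def o_def intro: bounded_linear_compose)

lemma bounded_clinear_funpow: "bounded_clinear T \<Longrightarrow> bounded_clinear (T ^^ n)"
proof (induction n)
  case 0
  then show ?case by (simp add: bounded_clinear_def id_def bounded_linear_ident)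
next
  case (Suc n)
  then show ?case by (simp only: funpow.simps bounded_clinear_comp)
qed

text \<open>Riesz for the real inner product supplies \<open>S\<close>; complex linearity upgrades
  the identity to \<open>cinner\<close>, and \<open>cinner_ext\<close> makes \<open>S\<close>
  unique.\<close>

lemma cadjoint:
  fixes T :: "'a::complex_hilbert \<Rightarrow> 'a"
  assumes T: "bounded_clinear T"
  shows "cinner (T x) y = cinner x (cadjoint T y)"
proof -
  note lin = bounded_clinearD[OF T]
  have "\<exists>w. \<forall>x. inner (T x) y = inner x w" for y
    by (metis riesz_representation bounded_linear_inner_left_comp lin(1))
  then obtain S where S: "\<And>x y. inner (T x) y = inner x (S y)" by metis
  have S': "cinner (T x) y = cinner x (S y)" for x y
  proof (rule complex_eqI)
    show "Re (cinner (T x) y) = Re (cinner x (S y))"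
      using S[of x y] by (simp add: inner_eq_Re_cinner)
    \<comment> \<open>The real part of \<open>-\<i> * z\<close> is the imaginary part of
      \<open>z\<close>.\<close>
    show "Im (cinner (T x) y) = Im (cinner x (S y))"
      using S[of "(-\<i>) *\<^sub>C x" y]
      by (simp only: inner_eq_Re_cinner cinner_scaleC_left lin) simp
  qed
  have "cadjoint T = S"
    unfolding cadjoint_def
  proof (rule the_equality)
    show "\<forall>x y. cinner (T x) y = cinner x (S y)" using S' by blast
    show "R = S" if "\<forall>x y. cinner (T x) y = cinner x (R y)" for R
    proof
      show "R y = S y" for y by (rule cinner_ext) (use that S' in metis)
    qed
  qed
  then show ?thesis using S' by simp
qed

lemma cadjoint': "bounded_clinear T \<Longrightarrow> cinner x (T y) = cinner (cadjoint T x) y"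
  for T :: "'a::complex_hilbert \<Rightarrow> 'a"
  by (metis cadjoint cinner_commute)

lemma cadjoint_zero: "bounded_clinear T \<Longrightarrow> cadjoint T 0 = 0"
  for T :: "'a::complex_hilbert \<Rightarrow> 'a"
  by (rule cinner_ext) (simp add: cadjoint[symmetric])

section \<open>Closed complex subspaces and closed spans\<close>

lemma closed_csubspace_Int:
  "closed_csubspace M \<Longrightarrow> closed_csubspace N \<Longrightarrow> closed_csubspace (M \<inter> N)"
  by (auto simp: closed_csubspace_def complex_vector.subspace_inter)

lemma closed_csubspace_vimage:
  assumes T: "bounded_clinear T" and "closed_csubspace M"
  shows "closed_csubspace (T -` M)"
  using assms bounded_clinearD[OF T]
  by (auto simp: closed_csubspace_def complex_vector.subspace_def
      intro!: closed_vimage linear_continuous_on)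

lemma closed_csubspace_ccspan: "closed_csubspace (ccspan S)"
proof -
  let ?V = "closure (cspan S)"
  have V: "cspan S \<subseteq> ?V" by (rule closure_subset)
  \<comment> \<open>Addition extends to the closure one summand at a time: first with
    \<open>y\<close> in the span, then with both summands in the closure.\<close>
  have "(\<lambda>x. x + y) ` ?V \<subseteq> ?V" if "y \<in> cspan S" for y
    using that V
    by (intro image_closure_subset) (auto intro!: continuous_intros complex_vector.span_add)
  then have "(\<lambda>y. x + y) ` ?V \<subseteq> ?V" if "x \<in> ?V" for x
    using that by (intro image_closure_subset) (auto intro!: continuous_intros)
  moreover have "(\<lambda>x. c *\<^sub>C x) ` ?V \<subseteq> ?V" for c
    using V by (intro image_closure_subset linear_continuous_on bounded_linear_scaleC) (auto intro: complex_vector.span_scale)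
  moreover have "0 \<in> ?V" using V complex_vector.span_zero by blast
  ultimately show ?thesis
    by (auto simp: closed_csubspace_def ccspan_def complex_vector.subspace_def image_subset_iff)
qed

lemma ccspan_superset: "S \<subseteq> ccspan S"
  unfolding ccspan_def using closure_subset complex_vector.span_superset by blast

lemma ccspan_minimal: "S \<subseteq> M \<Longrightarrow> closed_csubspace M \<Longrightarrow> ccspan S \<subseteq> M"
  unfolding ccspan_def closed_csubspace_def
  by (intro closure_minimal complex_vector.span_minimal) auto

text \<open>The preimage of \<open>M\<close> is itself a closed subspace, so it contains the closed
  span once it contains the generators.\<close>

lemma ccspan_image_subset:
  assumes "bounded_clinear T" "closed_csubspace M" "T ` S \<subseteq> M"
  shows "T ` ccspan S \<subseteq> M"
  using ccspan_minimal[of S "T -` M"] closed_csubspace_vimage[of T M] assms by blast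

section \<open>Orthogonal complements and projectors\<close>

definition orth_compl :: "'a::complex_inner set \<Rightarrow> 'a set"
  where "orth_compl M = {x. \<forall>y\<in>M. cinner x y = 0}"

lemma closed_csubspace_orth_compl: "closed_csubspace (orth_compl M)"
proof -
  have "closed {x. cinner x y = 0}" for y :: 'a
  proof -
    have "{x. cinner x y = 0} = {x. inner x y = 0} \<inter> {x. inner x (\<i> *\<^sub>C y) = 0}"
      by (auto simp: cinner_eq_inner complex_eq_iff)
    then show ?thesis by (auto intro!: closed_Int closed_Collect_eq continuous_intros)
  qed
  moreover have "orth_compl M = (\<Inter>y\<in>M. {x. cinner x y = 0})"
    by (auto simp: orth_compl_def)
  ultimately have "closed (orth_compl M)" by auto
  then show ?thesis
    by (auto simp: closed_csubspace_def complex_vector.subspace_def orth_compl_def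
        cinner_add_left cinner_scaleC_left)
qed

lemma subset_orth_compl_orth_compl: "M \<subseteq> orth_compl (orth_compl M)"
  using cinner_sym_zero by (auto simp: orth_compl_def)

text \<open>The description is meaningful for closed subspaces of a Hilbert space: existence comes
  from completeness, uniqueness from positive definiteness.\<close>

definition projector :: "'a::complex_inner set \<Rightarrow> 'a \<Rightarrow> 'a"
  where "projector M x = (THE m. m \<in> M \<and> x - m \<in> orth_compl M)"

lemma closed_csubspaceD:
  assumes "closed_csubspace M"
  shows "0 \<in> M" "x \<in> M \<Longrightarrow> y \<in> M \<Longrightarrow> x + y \<in> M" "x \<in> M \<Longrightarrow> y \<in> M \<Longrightarrow> x - y \<in> M" "x \<in> M \<Longrightarrow> c *\<^sub>C x \<in> M"
  using assms complex_vector.subspace_diff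
  by (auto simp: closed_csubspace_def complex_vector.subspace_def)

context
  fixes M :: "'a::complex_hilbert set"
  assumes M: "closed_csubspace M"
begin

lemma projector_eqI:
  assumes m: "m \<in> M" "x - m \<in> orth_compl M"
  shows "projector M x = m"
  unfolding projector_def
proof (rule the_equality)
  fix n assume n: "n \<in> M \<and> x - n \<in> orth_compl M"
  have "n - m \<in> M" using m n closed_csubspaceD[OF M] by blast
  moreover have "n - m = (x - m) - (x - n)" by simp
  then have "n - m \<in> orth_compl M"
    using m n closed_csubspaceD[OF closed_csubspace_orth_compl] by metis
  ultimately have "cinner (n - m) (n - m) = 0" by (auto simp: orth_compl_def)
  then show "n = m" by simp
qed (use m in blast)

lemma projector: "projector M x \<in> M" "x - projector M x \<in> orth_compl M"
proof -
  have "csubspace M" "closed M" using M by (auto simp: closed_csubspace_def)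
  then obtain m where m: "m \<in> M" "\<And>y. y \<in> M \<Longrightarrow> inner (x - m) y = 0"
    using real_projection_exists[of M x] csubspace_imp_subspace by blast
  \<comment> \<open>\<open>M\<close> is stable under multiplication by \<open>\<i>\<close>, so real
    orthogonality also kills the imaginary part of \<open>cinner\<close>.\<close>
  have "x - m \<in> orth_compl M"
    using m(2) closed_csubspaceD(4)[OF M] by (auto simp: orth_compl_def cinner_eq_inner complex_eq_iff)
  then show "projector M x \<in> M" "x - projector M x \<in> orth_compl M"
    using m(1) projector_eqI by auto
qed

lemma projector_ident: "x \<in> M \<Longrightarrow> projector M x = x"
  by (rule projector_eqI) (auto simp: closed_csubspaceD(1)[OF closed_csubspace_orth_compl])

lemma projector_self_adjoint: "cinner (projector M x) y = cinner x (projector M y)"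
proof -
  have "cinner (x - projector M x) (projector M y) = 0" "cinner (y - projector M y) (projector M x) = 0"
    using projector by (auto simp: orth_compl_def)
  then have "cinner x (projector M y) = cinner (projector M x) (projector M y)"
    "cinner (projector M x) y = cinner (projector M x) (projector M y)"
    using cinner_sym_zero[of "y - projector M y" "projector M x"]
    by (simp_all add: cinner_diff_left cinner_diff_right)
  then show ?thesis by simp
qed

lemma bounded_clinear_projector: "bounded_clinear (projector M)"
proof -
  note pe = projector_eqI closed_csubspaceD[OF M] projector
  note oc = closed_csubspaceD[OF closed_csubspace_orth_compl]
  have add: "projector M (x + y) = projector M x + projector M y" for x y
  proof (rule projector_eqI)
    show "x + y - (projector M x + projector M y) \<in> orth_compl M"
      using oc(2)[OF projector(2)[of x] projector(2)[of y]] by (simp add: algebra_simps)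
  qed (simp add: pe)
  have scale: "projector M (c *\<^sub>C x) = c *\<^sub>C projector M x" for c x
  proof (rule projector_eqI)
    show "c *\<^sub>C x - c *\<^sub>C projector M x \<in> orth_compl M"
      using oc(4)[OF projector(2)[of x]] by (simp add: complex_vector.scale_right_diff_distrib)
  qed (simp add: pe)
  have norm: "norm (projector M x) \<le> norm x * 1" for x
  proof -
    have "inner (x - projector M x) (projector M x) = 0"
      using projector[of x] by (auto simp: orth_compl_def inner_eq_Re_cinner)
    then have "norm (x - projector M x) ^ 2 = norm x ^ 2 - norm (projector M x) ^ 2"
      by (simp add: power2_norm_eq_inner inner_diff inner_commute)
    then have "norm (projector M x) ^ 2 \<le> norm x ^ 2" by (smt (verit) zero_le_power2)
    then show ?thesis using power2_le_imp_le[OF _ norm_ge_zero] by simp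
  qed
  show ?thesis
    unfolding bounded_clinear_def
    by (auto intro!: bounded_linear_intro[where K=1] simp: add scale scaleR_scaleC norm norm[simplified])
qed

text \<open>For \<open>x\<close> in the double complement, \<open>x - projector M x\<close> lies in
  both the complement and the double complement, so it is 0.\<close>

lemma orth_compl_orth_compl: "orth_compl (orth_compl M) = M"
proof (intro equalityI subsetI)
  fix x assume x: "x \<in> orth_compl (orth_compl M)"
  have "projector M x \<in> orth_compl (orth_compl M)"
    using projector(1)[of x] by (rule subsetD[OF subset_orth_compl_orth_compl])
  then have "x - projector M x \<in> orth_compl (orth_compl M)"
    using x closed_csubspaceD(3)[OF closed_csubspace_orth_compl] by blast
  then have "cinner (x - projector M x) (x - projector M x) = 0"
    using projector(2)[of x] by (auto simp: orth_compl_def)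
  then show "x \<in> M" using projector(1)[of x] by simp
qed (rule subsetD[OF subset_orth_compl_orth_compl])

end

section \<open>Reducing subspaces\<close>

text \<open>If \<open>T\<close> preserves the complement of \<open>M\<close>, its adjoint sends
  \<open>M\<close> into the double complement, which is \<open>M\<close> again.\<close>

lemma reducingI:
  fixes T :: "'a::complex_hilbert \<Rightarrow> 'a"
  assumes T: "bounded_clinear T" and M: "closed_csubspace M"
    and "T ` M \<subseteq> M" "T ` orth_compl M \<subseteq> orth_compl M"
  shows "reducing T M"
proof -
  have "cadjoint T x \<in> orth_compl (orth_compl M)" if "x \<in> M" for x
  proof -
    have "cinner (T y) x = 0" if "y \<in> orth_compl M" for y
      using that \<open>x \<in> M\<close> assms(4) by (auto simp: orth_compl_def)
    then show ?thesis
      using cinner_sym_zero by (auto simp: orth_compl_def cadjoint[OF T])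
  qed
  then show ?thesis using assms by (auto simp: reducing_def orth_compl_orth_compl[OF M])
qed

lemma reducing_orth_compl:
  fixes T :: "'a::complex_hilbert \<Rightarrow> 'a"
  assumes T: "bounded_clinear T" and "reducing T M"
  shows "reducing T (orth_compl M)"
  unfolding reducing_def
proof (intro conjI subsetI; (elim imageE)?)
  fix x y assume y: "y \<in> orth_compl M"
  show "x \<in> orth_compl M" if "x = T y"
    using y that assms(2) by (auto simp: reducing_def orth_compl_def cadjoint[OF T])
  show "x \<in> orth_compl M" if "x = cadjoint T y"
    using y that assms(2) by (auto simp: reducing_def orth_compl_def cadjoint'[OF T, symmetric])
qed (rule closed_csubspace_orth_compl)

lemma reducing_Int: "reducing T M \<Longrightarrow> reducing T N \<Longrightarrow> reducing T (M \<inter> N)"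
  by (auto simp: reducing_def closed_csubspace_Int)

text \<open>\<open>T\<close> respects the splitting of \<open>x\<close> along \<open>M\<close> and
  its complement. The second identity is the adjoint of the first, the projector being
  self-adjoint.\<close>

lemma projector_commute:
  fixes T :: "'a::complex_hilbert \<Rightarrow> 'a"
  assumes T: "bounded_clinear T" and red: "reducing T M"
  shows "projector M (T x) = T (projector M x)"
    and "projector M (cadjoint T x) = cadjoint T (projector M x)"
proof -
  have M: "closed_csubspace M" using red by (simp add: reducing_def)
  have 1: "projector M (T x) = T (projector M x)" for x
  proof (rule projector_eqI[OF M])
    show "T (projector M x) \<in> M" using projector(1)[OF M, of x] red by (auto simp: reducing_def)
    have "T ` orth_compl M \<subseteq> orth_compl M"
      using reducing_orth_compl[OF T red] by (simp add: reducing_def)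
    then have "T (x - projector M x) \<in> orth_compl M" using projector(2)[OF M, of x] by blast
    then show "T x - T (projector M x) \<in> orth_compl M" by (simp only: bounded_clinearD(4)[OF T])
  qed
  then show "projector M (T x) = T (projector M x)" .
  show "projector M (cadjoint T x) = cadjoint T (projector M x)"
    by (rule cinner_ext) (metis 1 T M cadjoint projector_self_adjoint)
qed

lemma projector_kernel_cadjoint:
  fixes T :: "'a::complex_hilbert \<Rightarrow> 'a"
  assumes T: "bounded_clinear T" and red: "reducing T M"
  shows "projector M ` op_kernel (cadjoint T) \<subseteq> op_kernel (cadjoint T)"
  using projector_commute(2)[OF T red, symmetric] red
  by (auto simp: op_kernel_def reducing_def projector_ident closed_csubspaceD(1))

lemma projector_commute_funpow:
  fixes T :: "'a::complex_hilbert \<Rightarrow> 'a"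
  assumes T: "bounded_clinear T" and red: "reducing T M"
  shows "projector M ((T ^^ n) x) = (T ^^ n) (projector M x)"
  by (induction n) (simp_all add: projector_commute[OF assms])

lemma funpow_image_subset: "T ` M \<subseteq> M \<Longrightarrow> (T ^^ n) ` M \<subseteq> M"
proof (induction n)
  case (Suc n)
  then have "T ` (T ^^ n) ` M \<subseteq> M" by blast
  then show ?case by (simp add: image_comp)
qed simp

lemma funpow_image_eq: "T ` M = M \<Longrightarrow> (T ^^ n) ` M = M"
proof (induction n)
  case (Suc n)
  then have "T ` (T ^^ n) ` M = M" by simp
  then show ?case by (simp add: image_comp)
qed simp

text \<open>The projector fixes \<open>M\<close> and sends a generator \<open>(T ^^ n) e\<close> to
  \<open>(T ^^ n) (projector M e)\<close> with \<open>projector M e\<close> in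
  \<open>M \<inter> E\<close>; by continuity it sends the whole closed span into the right-hand
  side.\<close>

lemma reducing_Int_ccspan_orbit:
  fixes T :: "'a::complex_hilbert \<Rightarrow> 'a"
  assumes T: "bounded_clinear T" and red: "reducing T M" and PE: "projector M ` E \<subseteq> E"
  shows "M \<inter> ccspan (\<Union>n. (T ^^ n) ` E) = ccspan (\<Union>n. (T ^^ n) ` (M \<inter> E))" (is "?L = ?R")
proof
  have M: "closed_csubspace M" using red by (simp add: reducing_def)
  have "projector M ` (\<Union>n. (T ^^ n) ` E) \<subseteq> (\<Union>n. (T ^^ n) ` (M \<inter> E))"
    using PE projector(1)[OF M] by (fastforce simp: projector_commute_funpow[OF T red])
  then have "projector M ` (\<Union>n. (T ^^ n) ` E) \<subseteq> ?R"
    using ccspan_superset by (rule subset_trans)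
  then have "projector M ` ccspan (\<Union>n. (T ^^ n) ` E) \<subseteq> ?R"
    by (rule ccspan_image_subset[OF bounded_clinear_projector[OF M] closed_csubspace_ccspan])
  then show "?L \<subseteq> ?R" using projector_ident[OF M] by force
  show "?R \<subseteq> ?L"
  proof (rule ccspan_minimal)
    have "(T ^^ n) ` M \<subseteq> M" for n
      using red by (intro funpow_image_subset) (simp add: reducing_def)
    then have "(\<Union>n. (T ^^ n) ` (M \<inter> E)) \<subseteq> M" by blast
    moreover have "(\<Union>n. (T ^^ n) ` (M \<inter> E)) \<subseteq> (\<Union>n. (T ^^ n) ` E)" by blast
    ultimately show "(\<Union>n. (T ^^ n) ` (M \<inter> E)) \<subseteq> ?L"
      using ccspan_superset[of "\<Union>n. (T ^^ n) ` E"] by blast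
    show "closed_csubspace ?L" by (rule closed_csubspace_Int[OF M closed_csubspace_ccspan])
  qed
qed

text \<open>The point is surjectivity, since an isometry may map an invariant subspace properly into
  itself. Here the adjoint inverts \<open>T\<close> on \<open>U\<close> and preserves
  \<open>M\<close>, so preimages stay in \<open>M\<close>.\<close>

lemma unitary_on_reducing_subset:
  fixes T :: "'a::complex_hilbert \<Rightarrow> 'a"
  assumes T: "bounded_clinear T" and U: "unitary_on T U" "reducing T U"
    and M: "reducing T M" "M \<subseteq> U"
  shows "unitary_on T M"
proof -
  have adj: "cadjoint T (T u) = u" if u: "u \<in> U" for u
  proof -
    \<comment> \<open>\<open>w\<close> lies in \<open>U\<close> because \<open>U\<close> is
      reducing, so the isometry identity can be tested against \<open>w\<close> itself.\<close>
    define w where "w = cadjoint T (T u) - u"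
    have "w \<in> U"
      using U(2) u by (auto simp: w_def reducing_def intro!: closed_csubspaceD)
    then have "cinner w (cadjoint T (T u)) = cinner w u"
      using U u by (auto simp: unitary_on_def cadjoint[OF T, symmetric])
    then have "cinner w w = 0" by (simp add: w_def cinner_diff_right)
    then show ?thesis by (simp add: w_def)
  qed
  have "M \<subseteq> T ` M"
  proof
    fix x assume x: "x \<in> M"
    then have "x \<in> T ` U" using M U by (auto simp: unitary_on_def)
    then obtain u where u: "u \<in> U" "x = T u" by blast
    then have "u = cadjoint T x" by (simp add: adj)
    then show "x \<in> T ` M" using x u M by (auto simp: reducing_def)
  qed
  then have "T ` M = M" using M by (auto simp: reducing_def)
  then show ?thesis using U(1) M(2) by (auto simp: unitary_on_def subset_iff)
qed

section \<open>Left invertible operators\<close>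

context
  fixes T :: "'a::complex_hilbert \<Rightarrow> 'a"
  assumes T: "bounded_clinear T" and inv: "left_invertible T"
begin

lemma op_kernel_cadjoint: "op_kernel (cadjoint T) = orth_compl (range T)"
proof -
  have "cadjoint T x = 0 \<longleftrightarrow> (\<forall>y. cinner (T y) x = 0)" for x
    using cinner_ext[of "cadjoint T x" 0] by (auto simp: cadjoint[OF T])
  then show ?thesis using cinner_sym_zero by (auto simp: op_kernel_def orth_compl_def)
qed

lemma closed_csubspace_range: "closed_csubspace (range T)"
proof -
  obtain L where L: "bounded_clinear L" "L \<circ> T = id" using inv by (auto simp: left_invertible_def)
  \<comment> \<open>A left inverse exhibits the range as the fixed-point set of the continuous map
    \<open>T \<circ> L\<close>.\<close>
  have "range T = {y. T (L y) = y}"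
    using L(2) by (auto simp: fun_eq_iff) (metis rangeI)
  moreover have "closed {y. T (L y) = y}"
    using linear_continuous_on[OF bounded_clinearD(1)[OF bounded_clinear_comp[OF T L(1)]], of UNIV]
    by (intro closed_Collect_eq continuous_on_id) (simp add: o_def)
  ultimately have "closed (range T)" by simp
  moreover have "csubspace (range T)"
    unfolding complex_vector.subspace_def
  proof (intro conjI ballI allI)
    show "0 \<in> range T" using bounded_clinearD(5)[OF T] by (metis rangeI)
    show "x + y \<in> range T" if "x \<in> range T" "y \<in> range T" for x y
      using that by (auto simp: bounded_clinearD(3)[OF T, symmetric])
    show "c *\<^sub>C x \<in> range T" if "x \<in> range T" for c x
      using that by (auto simp: bounded_clinearD(2)[OF T, symmetric])
  qed
  ultimately show ?thesis by (simp add: closed_csubspace_def)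
qed

text \<open>If \<open>T x\<close> is the projection of \<open>y\<close> onto the range, then
  \<open>cadjoint T y = cadjoint T (T x)\<close>. As \<open>cadjoint T \<circ> T\<close> is
  injective, the canonical left inverse returns this \<open>x\<close>, which is 0 exactly when
  \<open>cadjoint T y\<close> is.\<close>

lemma canonical_left_inverse_eq_0_iff:
  "canonical_left_inverse T y = 0 \<longleftrightarrow> y \<in> op_kernel (cadjoint T)"
proof -
  let ?S = "cadjoint T \<circ> T"
  have "inj T" using inv by (metis left_invertible_def inj_on_id inj_on_imageI2)
  have inj: "inj ?S"
  proof (rule injI)
    fix x z assume "?S x = ?S z"
    then have "cinner (T (x - z)) (T x) = cinner (T (x - z)) (T z)" by (simp add: cadjoint[OF T])
    then have "cinner (T (x - z)) (T (x - z)) = 0"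
      by (simp add: cinner_diff_right bounded_clinearD(4)[OF T])
    then have "T x = T z" by (simp add: bounded_clinearD(4)[OF T])
    then show "x = z" using \<open>inj T\<close> by (simp add: inj_eq)
  qed
  have S0: "?S 0 = 0" by (simp add: bounded_clinearD(5)[OF T] cadjoint_zero[OF T])
  obtain x where x: "T x = projector (range T) y"
    using projector(1)[OF closed_csubspace_range] by (metis imageE)
  have "cadjoint T y = ?S x"
  proof (rule cinner_ext)
    fix z
    have "cinner (y - T x) (T z) = 0"
      using projector(2)[OF closed_csubspace_range, of y] x by (auto simp: orth_compl_def)
    then show "cinner z (cadjoint T y) = cinner z (?S x)"
      by (metis T cadjoint cinner_diff_right cinner_sym_zero eq_iff_diff_eq_0 o_apply)
  qed
  then have "canonical_left_inverse T y = x"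
    using inv_f_eq[OF inj, of x "cadjoint T y"] by (simp add: canonical_left_inverse_def)
  then show ?thesis
    using inj_eq[OF inj, of x 0] S0 \<open>cadjoint T y = ?S x\<close> by (simp add: op_kernel_def)
qed

end

section \<open>Wold-type decompositions\<close>

text \<open>If \<open>x = m + n\<close> is orthogonal to \<open>M\<close>, pairing with
  \<open>m\<close> gives \<open>cinner m m = 0\<close>, so \<open>x = n\<close>.\<close>

lemma orthogonal_direct_sum_pairD:
  assumes "orthogonal_direct_sum [M, N]"
  shows "N = orth_compl M"
proof -
  have o: "cinner x y = 0" if "x \<in> M" "y \<in> N" for x y
    using assms that by (auto simp: orthogonal_direct_sum_def)
  show ?thesis
  proof (intro equalityI subsetI)
    show "x \<in> orth_compl M" if "x \<in> N" for x
      using o that cinner_sym_zero by (auto simp: orth_compl_def)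
    fix x assume x: "x \<in> orth_compl M"
    obtain m n where mn: "m \<in> M" "n \<in> N" "x = m + n"
      using assms by (force simp: orthogonal_direct_sum_def list_all2_Cons2)
    have "cinner m m = cinner x m - cinner n m" using mn by (simp add: cinner_add_left)
    also have "\<dots> = 0"
      using x mn o[of m n] cinner_sym_zero[of n m] by (simp add: orth_compl_def)
    finally show "x \<in> N" using mn by simp
  qed
qed

text \<open>By self-adjointness the projector onto \<open>U\<close> preserves the complement of
  \<open>V\<close> as well. Splitting \<open>x\<close> along \<open>V\<close> and then both pieces
  along \<open>U\<close> gives the four components.\<close>

lemma orthogonal_direct_sum_quadrants:
  fixes U V :: "'a::complex_hilbert set"
  assumes U: "closed_csubspace U" and V: "closed_csubspace V" and PV: "projector U ` V \<subseteq> V"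
  shows "orthogonal_direct_sum
    [U \<inter> V, U \<inter> orth_compl V, orth_compl U \<inter> V, orth_compl U \<inter> orth_compl V]"
proof -
  let ?P = "projector U"
  note V' = closed_csubspace_orth_compl[of V]
  have o: "cinner x y = 0" if "x \<in> M" "y \<in> orth_compl M" for x y and M :: "'a set"
    using that cinner_sym_zero[of x y] by (simp add: orth_compl_def)
  have PV': "?P x \<in> orth_compl V" if "x \<in> orth_compl V" for x
    using that PV by (auto simp: orth_compl_def projector_self_adjoint[OF U])
  have split: "\<exists>a b. a \<in> U \<inter> M \<and> b \<in> orth_compl U \<inter> M \<and> y = a + b"
    if "closed_csubspace M" "?P y \<in> M" "y \<in> M" for y M
    using that projector[OF U, of y] closed_csubspaceD(3)[of M y "?P y"]
    by (intro exI[of _ "?P y"] exI[of _ "y - ?P y"]) simp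
  have sum: "\<exists>xs. list_all2 (\<in>) xs
      [U \<inter> V, U \<inter> orth_compl V, orth_compl U \<inter> V, orth_compl U \<inter> orth_compl V] \<and> x = sum_list xs" for x
  proof -
    obtain a c where ac: "a \<in> U \<inter> V" "c \<in> orth_compl U \<inter> V" "projector V x = a + c"
      using split[OF V _ projector(1)[OF V]] PV projector(1)[OF V] by blast
    obtain b d where bd: "b \<in> U \<inter> orth_compl V" "d \<in> orth_compl U \<inter> orth_compl V"
        "x - projector V x = b + d"
      using split[OF V' _ projector(2)[OF V]] PV' projector(2)[OF V] by blast
    have "x = a + (b + (c + d))" using ac(3) bd(3) by (simp add: algebra_simps)
    then show ?thesis using ac bd by (intro exI[of _ "[a, b, c, d]"]) simp
  qed
  show ?thesis
    using sum o U V V' closed_csubspace_orth_compl[of U]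
    by (auto simp: orthogonal_direct_sum_def closed_csubspace_Int)
qed

text \<open>Collapses a nested closed span: by continuity \<open>T ^^ n\<close> maps the closed span
  of \<open>A\<close> into that of its image.\<close>

lemma ccspan_orbit_ccspan:
  fixes T :: "'a::complex_hilbert \<Rightarrow> 'a"
  assumes T: "bounded_clinear T"
  shows "ccspan (\<Union>n. (T ^^ n) ` ccspan A) = ccspan (\<Union>n. (T ^^ n) ` A)" (is "?L = ?R")
proof
  have "(T ^^ n) ` ccspan A \<subseteq> ?R" for n
  proof (rule ccspan_image_subset[OF bounded_clinear_funpow[OF T] closed_csubspace_ccspan])
    have "(T ^^ n) ` A \<subseteq> (\<Union>n. (T ^^ n) ` A)" by blast
    then show "(T ^^ n) ` A \<subseteq> ?R" using ccspan_superset by (rule subset_trans)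
  qed
  then show "?L \<subseteq> ?R" by (intro ccspan_minimal closed_csubspace_ccspan UN_least)
  have "(\<Union>n. (T ^^ n) ` A) \<subseteq> (\<Union>n. (T ^^ n) ` ccspan A)"
    using ccspan_superset by (intro UN_mono image_mono) auto
  then have "(\<Union>n. (T ^^ n) ` A) \<subseteq> ?L" using ccspan_superset by (rule subset_trans)
  then show "?R \<subseteq> ?L" by (rule ccspan_minimal[OF _ closed_csubspace_ccspan])
qed

lemma funpow_commute: "S \<circ> T = T \<circ> S \<Longrightarrow> S ((T ^^ n) x) = (T ^^ n) (S x)"
  by (induction n) (simp_all add: fun_eq_iff)

text \<open>\<open>S\<close> is an arbitrary function so that both commuting operators and
  projectors can be substituted.\<close>

lemma hyperrange_image_subset:
  assumes "\<And>n x. S ((T ^^ n) x) = (T ^^ n) (S x)"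
  shows "S ` hyperrange T \<subseteq> hyperrange T"
proof -
  have "S ` range (T ^^ n) \<subseteq> range (T ^^ n)" for n by (auto simp: assms)
  then show ?thesis unfolding hyperrange_def by blast
qed

lemma projector_hyperrange:
  fixes T :: "'a::complex_hilbert \<Rightarrow> 'a"
  assumes "bounded_clinear T" "reducing T M"
  shows "projector M ` hyperrange T \<subseteq> hyperrange T"
  using projector_commute_funpow[OF assms] by (rule hyperrange_image_subset)

lemma wold_type_decompositionD:
  assumes "wold_type_decomposition T"
  shows "bounded_clinear T" "left_invertible T" "reducing T (hyperrange T)"
    "unitary_on T (hyperrange T)"
    "orth_compl (hyperrange T) = ccspan (\<Union>m. (T ^^ m) ` op_kernel (cadjoint T))"
  using assms orthogonal_direct_sum_pairD[symmetric] by (auto simp: wold_type_decomposition_def)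

lemma Inter_funpow_image:
  fixes T :: "'a::complex_hilbert \<Rightarrow> 'a"
  assumes W: "wold_type_decomposition T" and M: "reducing T M"
  shows "(\<Inter>n. (T ^^ n) ` M) = M \<inter> hyperrange T"
proof
  note W = wold_type_decompositionD[OF W]
  \<comment> \<open>The index 0 contributes \<open>M\<close> itself; the positive indices give the
    hyperrange, which starts at 1.\<close>
  have "(\<Inter>n. (T ^^ n) ` M) \<subseteq> (T ^^ 0) ` M" by blast
  then show "(\<Inter>n. (T ^^ n) ` M) \<subseteq> M \<inter> hyperrange T"
    unfolding hyperrange_def by force
  have "unitary_on T (M \<inter> hyperrange T)"
    using unitary_on_reducing_subset[OF W(1,4,3) reducing_Int[OF M W(3)]] by simp
  then have "(T ^^ n) ` (M \<inter> hyperrange T) = M \<inter> hyperrange T" for n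
    by (intro funpow_image_eq) (simp add: unitary_on_def)
  then show "M \<inter> hyperrange T \<subseteq> (\<Inter>n. (T ^^ n) ` M)" by blast
qed

section \<open>Operators commuting with \<open>T\<close> and its canonical left inverse\<close>

context
  fixes S T :: "'a::complex_hilbert \<Rightarrow> 'a"
  assumes S: "bounded_clinear S" and T: "bounded_clinear T" "left_invertible T"
    and comm: "S \<circ> T = T \<circ> S"
    and cli: "canonical_left_inverse T \<circ> S = S \<circ> canonical_left_inverse T"
begin

text \<open>This kernel is that of the canonical left inverse, which commutes with \<open>S\<close>;
  its complement is the range of \<open>T\<close>, invariant because \<open>S\<close> commutes with
  \<open>T\<close>.\<close>

lemma reducing_kernel_cadjoint: "reducing S (op_kernel (cadjoint T))"
proof (rule reducingI[OF S])
  show "closed_csubspace (op_kernel (cadjoint T))"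
    by (simp add: op_kernel_cadjoint[OF T] closed_csubspace_orth_compl)
  show "S ` op_kernel (cadjoint T) \<subseteq> op_kernel (cadjoint T)"
  proof safe
    fix x assume "x \<in> op_kernel (cadjoint T)"
    then have "canonical_left_inverse T x = 0" by (simp add: canonical_left_inverse_eq_0_iff[OF T])
    then have "canonical_left_inverse T (S x) = 0"
      using fun_cong[OF cli, of x] by (simp add: bounded_clinearD(5)[OF S])
    then show "S x \<in> op_kernel (cadjoint T)" by (simp add: canonical_left_inverse_eq_0_iff[OF T])
  qed
  have "orth_compl (op_kernel (cadjoint T)) = range T"
    by (simp add: op_kernel_cadjoint[OF T] orth_compl_orth_compl closed_csubspace_range[OF T])
  moreover have "S ` range T \<subseteq> range T" using fun_cong[OF comm] by (auto simp: image_iff)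
  ultimately show "S ` orth_compl (op_kernel (cadjoint T)) \<subseteq> orth_compl (op_kernel (cadjoint T))"
    by simp
qed

text \<open>The complement is the closed span of the images of the kernel under powers of
  \<open>T\<close>; \<open>S\<close> preserves each image, as it preserves the kernel and commutes
  with \<open>T\<close>.\<close>

lemma reducing_hyperrange:
  assumes W: "wold_type_decomposition T"
  shows "reducing S (hyperrange T)"
proof (rule reducingI[OF S])
  note W = wold_type_decompositionD[OF W]
  show "closed_csubspace (hyperrange T)" using W(3) by (simp add: reducing_def)
  show "S ` hyperrange T \<subseteq> hyperrange T"
    using funpow_commute[OF comm] by (rule hyperrange_image_subset)
  have "S ` (T ^^ n) ` op_kernel (cadjoint T) \<subseteq> (T ^^ n) ` op_kernel (cadjoint T)" for n
    using reducing_kernel_cadjoint by (auto simp: funpow_commute[OF comm] reducing_def)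
  then have "S ` (\<Union>n. (T ^^ n) ` op_kernel (cadjoint T)) \<subseteq> (\<Union>n. (T ^^ n) ` op_kernel (cadjoint T))"
    by blast
  then show "S ` orth_compl (hyperrange T) \<subseteq> orth_compl (hyperrange T)"
    unfolding W(5)
    by (intro ccspan_image_subset[OF S closed_csubspace_ccspan] subset_trans[OF _ ccspan_superset])
qed

end

section \<open>The four-part splitting for a commuting pair\<close>

theorem theorem2p13:
  fixes T1 T2 :: "'a::complex_hilbert \<Rightarrow> 'a"
    and E1 E2 H00 H01 H10 H11 :: "'a set"
  assumes "separable_space (euclidean :: 'a topology)"
    and "left_inverse_commuting [T1, T2]"
    and "wold_type_decomposition T1"
    and "wold_type_decomposition T2"
    and "E1 = op_kernel (cadjoint T1)"
    and "E2 = op_kernel (cadjoint T2)"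
    and "H00 = (\<Inter>m. \<Inter>n. range (T1 ^^ m \<circ> T2 ^^ n))"
    and "H01 = ccspan (\<Union>n. (T2 ^^ n) ` (\<Inter>m. (T1 ^^ m) ` E2))"
    and "H10 = (\<Inter>n. (T2 ^^ n) ` ccspan (\<Union>m. (T1 ^^ m) ` E1))"
    and "H11 = ccspan (\<Union>m. \<Union>n. (T1 ^^ m \<circ> T2 ^^ n) ` (E1 \<inter> E2))"
  shows "orthogonal_direct_sum [H00, H01, H10, H11]
    \<and> (\<forall>M\<in>{H00, H01, H10, H11}. reducing T1 M \<and> reducing T2 M)
    \<and> unitary_on T1 H00 \<and> unitary_on T1 H01
    \<and> unitary_on T2 H00 \<and> unitary_on T2 H10"
proof -
  note W1 = wold_type_decompositionD[OF assms(3)] and W2 = wold_type_decompositionD[OF assms(4)]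
  have lic: "[T1, T2] ! i \<circ> [T1, T2] ! j = [T1, T2] ! j \<circ> [T1, T2] ! i"
    "canonical_left_inverse ([T1, T2] ! i) \<circ> [T1, T2] ! j = [T1, T2] ! j \<circ> canonical_left_inverse ([T1, T2] ! i)"
    if "i < length [T1, T2]" "j < length [T1, T2]" "i \<noteq> j" for i j
    using assms(2) that unfolding left_inverse_commuting_def by blast+
  have comm12: "T1 \<circ> T2 = T2 \<circ> T1" and comm21: "T2 \<circ> T1 = T1 \<circ> T2"
    and cli1: "canonical_left_inverse T1 \<circ> T2 = T2 \<circ> canonical_left_inverse T1"
    and cli2: "canonical_left_inverse T2 \<circ> T1 = T1 \<circ> canonical_left_inverse T2"
    using lic(1)[of 0 1] lic(1)[of 1 0] lic(2)[of 0 1] lic(2)[of 1 0] by auto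
  let ?U1 = "hyperrange T1" and ?U2 = "hyperrange T2"
  let ?V1 = "orth_compl ?U1" and ?V2 = "orth_compl ?U2"
  note V1 = W1(5)[folded assms(5)] and V2 = W2(5)[folded assms(6)]
  have E2: "reducing T1 E2"
    unfolding assms(6) by (rule reducing_kernel_cadjoint[OF W1(1) W2(1,2) comm12 cli2])
  have U1: "reducing T1 ?U1" "reducing T2 ?U1"
    using W1(3) reducing_hyperrange[OF W2(1) W1(1,2) comm21 cli1 assms(3)] by auto
  have U2: "reducing T1 ?U2" "reducing T2 ?U2"
    using W2(3) reducing_hyperrange[OF W1(1) W2(1,2) comm12 cli2 assms(4)] by auto
  have rV1: "reducing T1 ?V1" "reducing T2 ?V1"
    using U1 reducing_orth_compl[OF W1(1)] reducing_orth_compl[OF W2(1)] by auto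
  have rV2: "reducing T1 ?V2" "reducing T2 ?V2"
    using U2 reducing_orth_compl[OF W1(1)] reducing_orth_compl[OF W2(1)] by auto
  have unitary1: "unitary_on T1 (?U1 \<inter> M)" if "reducing T1 M" for M
    using unitary_on_reducing_subset[OF W1(1,4,3) reducing_Int[OF W1(3) that]] by simp
  have unitary2: "unitary_on T2 (M \<inter> ?U2)" if "reducing T2 M" for M
    using unitary_on_reducing_subset[OF W2(1,4,3) reducing_Int[OF that W2(3)]] by simp

  have H00: "H00 = ?U1 \<inter> ?U2"
  proof
    have "H00 \<subseteq> range (T1 ^^ m)" "H00 \<subseteq> range (T2 ^^ m)" for m
    proof -
      \<comment> \<open>Setting one exponent to 0 isolates the powers of the other operator.\<close>
      have "H00 \<subseteq> range (T1 ^^ m \<circ> T2 ^^ 0)" "H00 \<subseteq> range (T1 ^^ 0 \<circ> T2 ^^ m)"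
        unfolding assms(7) by blast+
      then show "H00 \<subseteq> range (T1 ^^ m)" "H00 \<subseteq> range (T2 ^^ m)" by auto
    qed
    then show "H00 \<subseteq> ?U1 \<inter> ?U2" unfolding hyperrange_def by blast
    \<comment> \<open>Both operators are unitary on \<open>?U1 \<inter> ?U2\<close>, so every
      product of powers maps it onto itself.\<close>
    have "(T1 ^^ m) ` (?U1 \<inter> ?U2) = ?U1 \<inter> ?U2" "(T2 ^^ m) ` (?U1 \<inter> ?U2) = ?U1 \<inter> ?U2" for m
      using unitary1[OF U2(1)] unitary2[OF U1(2)]
      by (auto simp only: unitary_on_def intro!: funpow_image_eq)
    then have "(T1 ^^ m \<circ> T2 ^^ n) ` (?U1 \<inter> ?U2) = ?U1 \<inter> ?U2" for m n
      by (simp only: image_comp[symmetric])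
    then show "?U1 \<inter> ?U2 \<subseteq> H00" unfolding assms(7) by blast
  qed
  \<comment> \<open>The inner intersection is computed for \<open>T1\<close> on its reducing
    subspace \<open>E2\<close>; the outer span is then the \<open>?U1\<close> part of the span
    \<open>?V2\<close>.\<close>
  have "H01 = ccspan (\<Union>n. (T2 ^^ n) ` (?U1 \<inter> E2))"
    unfolding assms(8) by (simp add: Inter_funpow_image[OF assms(3) E2] Int_commute)
  also have "\<dots> = ?U1 \<inter> ?V2"
    unfolding V2 using projector_kernel_cadjoint[OF W2(1) U1(2)]
    by (intro reducing_Int_ccspan_orbit[OF W2(1) U1(2), symmetric]) (simp add: assms(6))
  finally have H01: "H01 = ?U1 \<inter> ?V2" .
  have H10: "H10 = ?V1 \<inter> ?U2"
    unfolding assms(9) V1[symmetric] by (rule Inter_funpow_image[OF assms(4) rV1(2)])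
  \<comment> \<open>The orbit lemma is used twice: for \<open>T2\<close> with
    \<open>M = ?V1\<close>, then for \<open>T1\<close> with \<open>M = E2\<close>. Flattening the
    spans and reordering the powers gives \<open>H11\<close>.\<close>
  have "?V1 \<inter> ?V2 = ccspan (\<Union>n. (T2 ^^ n) ` (?V1 \<inter> E2))"
    unfolding V2 using projector_kernel_cadjoint[OF W2(1) rV1(2)]
    by (intro reducing_Int_ccspan_orbit[OF W2(1) rV1(2)]) (simp add: assms(6))
  also have "?V1 \<inter> E2 = ccspan (\<Union>m. (T1 ^^ m) ` (E2 \<inter> E1))"
    unfolding V1 Int_commute[of _ E2] using projector_kernel_cadjoint[OF W1(1) E2]
    by (intro reducing_Int_ccspan_orbit[OF W1(1) E2]) (simp add: assms(5))
  also have "ccspan (\<Union>n. (T2 ^^ n) ` \<dots>) = ccspan (\<Union>n. (T2 ^^ n) ` (\<Union>m. (T1 ^^ m) ` (E2 \<inter> E1)))"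
    by (rule ccspan_orbit_ccspan[OF W2(1)])
  also have "(\<Union>n. (T2 ^^ n) ` (\<Union>m. (T1 ^^ m) ` (E2 \<inter> E1)))
      = (\<Union>m. \<Union>n. (T1 ^^ m \<circ> T2 ^^ n) ` (E1 \<inter> E2))"
  proof -
    have "T2 ^^ n \<circ> T1 ^^ m = T1 ^^ m \<circ> T2 ^^ n" for m n
    proof -
      \<comment> \<open>First \<open>T1\<close> is moved past powers of \<open>T2\<close>, then a
        fixed power of \<open>T2\<close> past powers of \<open>T1\<close>.\<close>
      have "T1 \<circ> T2 ^^ n = T2 ^^ n \<circ> T1" using funpow_commute[OF comm12] by (simp add: fun_eq_iff)
      then have "T2 ^^ n \<circ> T1 = T1 \<circ> T2 ^^ n" by (rule sym)
      from funpow_commute[OF this] show ?thesis by (simp add: fun_eq_iff)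
    qed
    then show ?thesis
      unfolding image_UN image_comp Int_commute[of E2] by (subst SUP_commute) simp
  qed
  finally have H11: "H11 = ?V1 \<inter> ?V2" unfolding assms(10) by (rule sym)

  have "closed_csubspace ?U1" "closed_csubspace ?U2" using U1 U2 by (auto simp: reducing_def)
  \<comment> \<open>As \<open>?U1\<close> reduces \<open>T2\<close>, its projector commutes with the
    powers of \<open>T2\<close> and so preserves \<open>?U2\<close>.\<close>
  then have "orthogonal_direct_sum [H00, H01, H10, H11]"
    unfolding H00 H01 H10 H11
    by (rule orthogonal_direct_sum_quadrants) (rule projector_hyperrange[OF W2(1) U1(2)])
  moreover have "\<forall>M\<in>{H00, H01, H10, H11}. reducing T1 M \<and> reducing T2 M"
    unfolding H00 H01 H10 H11 using U1 U2 rV1 rV2 by (auto intro: reducing_Int)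
  moreover have "unitary_on T1 H00" "unitary_on T1 H01" "unitary_on T2 H00" "unitary_on T2 H10"
    unfolding H00 H01 H10 using unitary1 unitary2 U1 U2 rV1 rV2 by auto
  ultimately show ?thesis by blast
qed

end
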